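(* Let $W$ be an infinite-dimensional separable Banach space. There does not exist a translation-invariant Borel measure on $W$ which assigns positive finite measure to open balls. In fact, any translation-invariant Borel measure $m$ on $W$ is either the zero measure or assigns infinite measure to every nonempty open set.
   Context: A Borel measure $m$ on $W$ is a countably additive measure with values in $[0,\infty]$ on the Borel $\sigma$-algebra of $W$ (norm topology). It is translation-invariant if $m(A+y)=m(A)$ for all Borel $A\subset W$ and all $y\in W$. *)

theory Defs
  imports "HOL-Analysis.Analysis"
begin

definition borel_measure :: "'a::topological_space measure \<Rightarrow> bool" where
  "borel_measure m \<longleftrightarrow> sets m = sets borel"

definition translation_invariant :: "'a::real_normed_vector measure \<Rightarrow> bool" where
  "translation_invariant m \<longleftrightarrow>
     (\<forall>A\<in>sets borel. \<forall>y. emeasure m ((\<lambda>a. a + y) ` A) = emeasure m A)"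

end

theory Submission
  imports Defs
begin

text \<open>
  In infinite dimension a ball of radius \<open>r\<close> contains arbitrarily many pairwise disjoint balls
  of one common radius \<open>r/8\<close>. These small balls are translates of one another, so an invariant
  measure gives all of them the same mass; if the big ball has finite mass, that common mass
  must be zero. By separability countably many translates of the small ball cover the space, so
  the whole measure vanishes. Hence a nonzero invariant measure is infinite on every nonempty
  open set, and then no measure can be positive and finite on balls.

  The disjoint balls come from a form of Riesz's theorem: if finitely many balls of radius
  \<open>1/2\<close> cover the unit ball, their centres span the space
  (\<open>span_eq_UNIV_if_half_balls_cover\<close>). So in infinite dimension a finite set of
  \<open>1/2\<close>-separated points of the unit ball can always be enlarged
  (\<open>exists_separated_set\<close>).
\<close>

text \<open>
  A point \<open>x\<close> of the unit ball has a binary expansion \<open>x = (\<Sum>n. (1/2)^n *\<^sub>R f n)\<close> whose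
  digits \<open>f n\<close> are centres: choose a centre within \<open>1/2\<close> of the current remainder, subtract
  it, double the difference, and repeat. As there are only finitely many centres, the terms can
  be collected by their digit; the coefficient of each centre is a subseries of the geometric
  series, so \<open>x\<close> is a linear combination of the centres. Compared with showing that the span is
  dense, this avoids having to prove that finite-dimensional subspaces are closed.
\<close>

lemma span_eq_UNIV_if_half_balls_cover:
  fixes F :: "'a::real_normed_vector set"
  assumes "finite F" and cover: "ball 0 1 \<subseteq> (\<Union>f\<in>F. ball f (1/2))"
  shows "span F = UNIV"
proof -
  have "\<forall>x\<in>ball 0 1. \<exists>f\<in>F. dist f x < 1/2"
    using cover by fastforce
  then obtain g where g: "\<And>x. norm x < 1 \<Longrightarrow> g x \<in> F \<and> dist (g x) x < 1/2"
    by (metis mem_ball_0)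
  have ball: "x \<in> span F" if x: "norm x < 1" for x
  proof -
    define y where "y n = ((\<lambda>z. 2 *\<^sub>R (z - g z)) ^^ n) x" for n
    have y0: "y 0 = x" and ySuc: "y (Suc n) = 2 *\<^sub>R (y n - g (y n))" for n
      by (simp_all add: y_def)
    have y: "norm (y n) < 1" for n
    proof (induction n)
      case (Suc n)
      then have "dist (g (y n)) (y n) < 1/2" using g by blast
      then show ?case by (simp add: ySuc dist_norm norm_minus_commute)
    qed (simp add: y0 x)
    have expansion: "x - (\<Sum>n<N. (1/2)^n *\<^sub>R g (y n)) = (1/2)^N *\<^sub>R y N" for N
    proof (induction N)
      case (Suc N)
      then show ?case by (simp add: ySuc algebra_simps)
    qed (simp add: y0)
    define c where "c f n = (if g (y n) = f then (1/2::real)^n else 0)" for f n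
    have "summable (c f)" for f
      by (rule summable_comparison_test[of _ "\<lambda>n. (1/2::real)^n"])
         (auto simp: c_def intro!: summable_geometric)
    then have "(\<lambda>N. \<Sum>f\<in>F. (\<Sum>n<N. c f n) *\<^sub>R f) \<longlonglongrightarrow> (\<Sum>f\<in>F. suminf (c f) *\<^sub>R f)"
      by (intro tendsto_intros summable_LIMSEQ)
    moreover have "(\<Sum>f\<in>F. (\<Sum>n<N. c f n) *\<^sub>R f) = (\<Sum>n<N. (1/2)^n *\<^sub>R g (y n))" for N
    proof -
      have "(\<Sum>f\<in>F. (\<Sum>n<N. c f n) *\<^sub>R f) = (\<Sum>n<N. \<Sum>f\<in>F. c f n *\<^sub>R f)"
        by (simp add: scaleR_sum_left sum.swap[of _ "{..<N}" F])
      also have "\<dots> = (\<Sum>n<N. (1/2)^n *\<^sub>R g (y n))"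
      proof (rule sum.cong[OF refl])
        fix n
        have "(\<Sum>f\<in>F. c f n *\<^sub>R f) = (\<Sum>f\<in>F. if f = g (y n) then (1/2)^n *\<^sub>R f else 0)"
          by (rule sum.cong) (auto simp: c_def)
        also have "\<dots> = (1/2)^n *\<^sub>R g (y n)"
          using g[OF y[of n]] \<open>finite F\<close> by simp
        finally show "(\<Sum>f\<in>F. c f n *\<^sub>R f) = (1/2)^n *\<^sub>R g (y n)" .
      qed
      finally show ?thesis .
    qed
    ultimately have "(\<lambda>N. \<Sum>n<N. (1/2)^n *\<^sub>R g (y n)) \<longlonglongrightarrow> (\<Sum>f\<in>F. suminf (c f) *\<^sub>R f)"
      by simp
    moreover have "(\<lambda>N. \<Sum>n<N. (1/2)^n *\<^sub>R g (y n)) \<longlonglongrightarrow> x"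
    proof (rule LIM_zero_cancel, rule tendsto_norm_zero_cancel,
           rule tendsto_sandwich[of "\<lambda>_. 0" _ _ "\<lambda>N. (1/2::real)^N"])
      have "norm ((\<Sum>n<N. (1/2)^n *\<^sub>R g (y n)) - x) \<le> (1/2)^N" for N
        using y[of N] by (subst norm_minus_commute) (simp add: expansion mult_left_le)
      then show "\<forall>\<^sub>F N in sequentially. norm ((\<Sum>n<N. (1/2)^n *\<^sub>R g (y n)) - x) \<le> (1/2)^N"
        by simp
      show "(\<lambda>N. (1/2::real)^N) \<longlonglongrightarrow> 0" by (simp add: LIMSEQ_realpow_zero)
    qed auto
    ultimately have "x = (\<Sum>f\<in>F. suminf (c f) *\<^sub>R f)"
      using LIMSEQ_unique by blast
    then show ?thesis
      by (simp add: span_sum span_scale span_base)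
  qed
  have "x \<in> span F" for x
  proof -
    define t where "t = norm x + 1"
    have "t > 0" by (simp add: t_def add_nonneg_pos)
    then have "norm ((1/t) *\<^sub>R x) < 1" by (simp add: t_def)
    then have "t *\<^sub>R ((1/t) *\<^sub>R x) \<in> span F" by (intro span_scale ball)
    then show ?thesis using \<open>t > 0\<close> by simp
  qed
  then show ?thesis by blast
qed

lemma finite_dimensional_if_finite_span:
  fixes F :: "'a::real_vector set"
  assumes "finite F" "span F = UNIV"
  shows "\<exists>B :: 'a set. finite_dimensional_vector_space (*\<^sub>R) B"
proof -
  obtain B where B: "B \<subseteq> F" "independent B" "F \<subseteq> span B"
    using maximal_independent_subset by blast
  have "span B = UNIV"
    using span_minimal[OF B(3) subspace_span] assms(2) by blast
  then have "finite_dimensional_vector_space (*\<^sub>R) B"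
    using B(2) finite_subset[OF B(1) assms(1)]
    by unfold_locales (simp_all flip: dependent_raw_def span_raw_def)
  then show ?thesis by blast
qed

lemma exists_separated_set:
  assumes "\<nexists>B :: 'a::real_normed_vector set. finite_dimensional_vector_space (*\<^sub>R) B"
  shows "\<exists>S :: 'a set. finite S \<and> card S = N \<and> S \<subseteq> ball 0 1 \<and>
           pairwise (\<lambda>x y. 1/2 \<le> dist x y) S"
proof (induction N)
  case 0
  then show ?case by (intro exI[of _ "{}"]) simp
next
  case (Suc N)
  then obtain S :: "'a set" where S: "finite S" "card S = N" "S \<subseteq> ball 0 1"
      "pairwise (\<lambda>x y. 1/2 \<le> dist x y) S"
    by blast
  have "\<not> ball 0 1 \<subseteq> (\<Union>f\<in>S. ball f (1/2))"
    using span_eq_UNIV_if_half_balls_cover[OF S(1)] finite_dimensional_if_finite_span[OF S(1)] assms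
    by metis
  then obtain x where x: "x \<in> ball 0 1" "\<And>f. f \<in> S \<Longrightarrow> 1/2 \<le> dist f x"
    by (auto simp: subset_iff not_less simp del: mem_ball_0)
  then have "x \<notin> S" by fastforce
  moreover have "pairwise (\<lambda>x y. 1/2 \<le> dist x y) (insert x S)"
    using S(4) x(2) by (auto simp: pairwise_insert dist_commute)
  ultimately show ?case
    using S x(1) by (intro exI[of _ "insert x S"]) auto
qed

lemma emeasure_ball_translation_invariant:
  fixes m :: "'a::real_normed_vector measure"
  assumes "translation_invariant m"
  shows "emeasure m (ball x r) = emeasure m (ball 0 r)"
proof -
  have "(\<lambda>a. a + x) ` ball 0 r = ball x r"
    using ball_translation[of x 0 r] by (simp add: add.commute)
  then show ?thesis
    using assms unfolding translation_invariant_def by (metis borel_open open_ball)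
qed

text \<open>
  The radius \<open>r/8\<close> arises by shrinking \<open>1/2\<close>-separated points of the unit ball by the factor
  \<open>r/2\<close>: the centres then have mutual distance at least \<open>r/4\<close>, so the balls of radius
  \<open>r/8\<close> around them are disjoint, and these stay inside the ball of radius
  \<open>r/2 + r/8 < r\<close>.
\<close>

lemma emeasure_small_ball_eq_0:
  fixes m :: "'a::real_normed_vector measure"
  assumes infinite_dim: "\<nexists>B :: 'a set. finite_dimensional_vector_space (*\<^sub>R) B"
    and m: "borel_measure m" "translation_invariant m"
    and r: "r > 0" and fin: "emeasure m (ball x r) < \<infinity>"
  shows "emeasure m (ball 0 (r/8)) = 0"
proof (rule ccontr)
  define e where "e = emeasure m (ball 0 (r/8))"
  assume "emeasure m (ball 0 (r/8)) \<noteq> 0"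
  then have "e \<noteq> 0" by (simp add: e_def)
  have sets: "sets m = sets borel"
    using m(1) by (simp add: borel_measure_def)
  have bound: "of_nat N * e \<le> emeasure m (ball x r)" for N
  proof -
    obtain S :: "'a set" where S: "finite S" "card S = N" "S \<subseteq> ball 0 1"
        "pairwise (\<lambda>x y. 1/2 \<le> dist x y) S"
      using exists_separated_set[OF infinite_dim] by blast
    define B where "B s = ball (x + (r/2) *\<^sub>R s) (r/8)" for s
    have "disjoint_family_on B S"
      unfolding disjoint_family_on_def
    proof (intro ballI impI)
      fix s t assume st: "s \<in> S" "t \<in> S" "s \<noteq> t"
      have "dist (x + (r/2) *\<^sub>R s) (x + (r/2) *\<^sub>R t) = (r/2) * dist s t"
        using r by (simp add: dist_norm flip: scaleR_diff_right)
      also have "\<dots> \<ge> (r/2) * (1/2)"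
        using S(4) st r by (intro mult_left_mono) (auto simp: pairwise_def)
      finally show "B s \<inter> B t = {}"
        unfolding B_def by (intro disjoint_ballI) simp
    qed
    moreover have "B ` S \<subseteq> sets m"
      by (auto simp: B_def sets)
    ultimately have "(\<Sum>s\<in>S. emeasure m (B s)) = emeasure m (\<Union>s\<in>S. B s)"
      using S(1) by (intro sum_emeasure)
    also have "\<dots> \<le> emeasure m (ball x r)"
    proof (rule emeasure_mono)
      show "(\<Union>s\<in>S. B s) \<subseteq> ball x r"
      proof
        fix z assume "z \<in> (\<Union>s\<in>S. B s)"
        then obtain s where s: "s \<in> S" "dist (x + (r/2) *\<^sub>R s) z < r/8"
          by (auto simp: B_def)
        have "dist x (x + (r/2) *\<^sub>R s) = (r/2) * norm s"
          using r by (simp add: dist_norm)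
        also have "\<dots> \<le> (r/2) * 1"
          using S(3) s(1) r by (intro mult_left_mono) fastforce+
        finally show "z \<in> ball x r"
          using s(2) r dist_triangle[of x z "x + (r/2) *\<^sub>R s"] by simp
      qed
    qed (simp add: sets)
    also have "(\<Sum>s\<in>S. emeasure m (B s)) = of_nat N * e"
      using S(2) by (simp add: B_def e_def emeasure_ball_translation_invariant[OF m(2), of "_ + _"])
    finally show ?thesis .
  qed
  have "(SUP N. of_nat N * e) = top"
    unfolding SUP_mult_right_ennreal[symmetric] ennreal_SUP_of_nat_eq_top
    using \<open>e \<noteq> 0\<close> by (simp add: ennreal_top_mult)
  moreover have "(SUP N. of_nat N * e) \<le> emeasure m (ball x r)"
    by (rule SUP_least) (rule bound)
  ultimately show False using fin by (simp only: infinity_ennreal_def leD)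
qed

lemma null_measure_if_null_ball:
  fixes m :: "'a::real_normed_vector measure"
  assumes separable: "separable_space (euclidean :: 'a topology)"
    and m: "borel_measure m" "translation_invariant m"
    and r: "r > 0" and null: "emeasure m (ball 0 r) = 0"
  shows "m = null_measure borel"
proof -
  have sets: "sets m = sets borel"
    using m(1) by (simp add: borel_measure_def)
  obtain D :: "'a set" where D: "countable D" "closure D = UNIV"
    using separable by (auto simp: separable_space_def)
  have "(\<Union>d\<in>D. ball d r) = UNIV"
    using D(2) r by (auto simp: closure_approachable set_eq_iff)
  moreover have "(\<Union>d\<in>D. ball d r) \<in> null_sets m"
  proof (rule null_sets_UN'[OF D(1)])
    show "ball d r \<in> null_sets m" for d
      using null emeasure_ball_translation_invariant[OF m(2), of d r]
      by (simp add: null_sets_def sets)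
  qed
  ultimately have "emeasure m UNIV = 0" by (simp add: null_sets_def)
  then have "emeasure m A = 0" if "A \<in> sets borel" for A
    using emeasure_mono[of A UNIV m] by (simp add: sets)
  then show ?thesis
    by (intro measure_eqI) (simp_all add: sets)
qed

theorem theorem1p1:
  assumes infinite_dim: "\<nexists>B :: 'w::banach set. finite_dimensional_vector_space (*\<^sub>R) B"
    and separable: "separable_space (euclidean :: 'w topology)"
  shows "(\<nexists>m :: 'w measure. borel_measure m \<and> translation_invariant m \<and>
            (\<forall>x r. r > 0 \<longrightarrow> 0 < emeasure m (ball x r) \<and> emeasure m (ball x r) < \<infinity>)) \<and>
         (\<forall>m :: 'w measure. borel_measure m \<and> translation_invariant m \<longrightarrow>
            m = null_measure borel \<or>
            (\<forall>U. open U \<and> U \<noteq> {} \<longrightarrow> emeasure m U = \<infinity>))"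
proof -
  have dichotomy: "m = null_measure borel \<or> (\<forall>U. open U \<and> U \<noteq> {} \<longrightarrow> emeasure m U = \<infinity>)"
    if m: "borel_measure m" "translation_invariant m" for m :: "'w measure"
  proof (rule disjCI, rule ccontr)
    assume nonnull: "m \<noteq> null_measure borel"
    assume "\<not> (\<forall>U. open U \<and> U \<noteq> {} \<longrightarrow> emeasure m U = \<infinity>)"
    then obtain U x where U: "open U" "x \<in> U" "emeasure m U < \<infinity>"
      by (auto simp: less_top)
    then obtain r where r: "r > 0" "ball x r \<subseteq> U"
      using open_contains_ball by blast
    have "emeasure m (ball x r) \<le> emeasure m U"
      using r(2) U(1) m(1) by (intro emeasure_mono) (auto simp: borel_measure_def)
    then have "emeasure m (ball x r) < \<infinity>"
      using U(3) by (rule le_less_trans)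
    then have "emeasure m (ball 0 (r/8)) = 0"
      using emeasure_small_ball_eq_0[OF infinite_dim m r(1)] by blast
    then have "m = null_measure borel"
      using null_measure_if_null_ball[OF separable m, of "r/8"] r(1) by simp
    with nonnull show False by blast
  qed
  have "\<not> (\<forall>x r. r > 0 \<longrightarrow> 0 < emeasure m (ball x r) \<and> emeasure m (ball x r) < \<infinity>)"
    if m: "borel_measure m" "translation_invariant m" for m :: "'w measure"
  proof
    assume pos_fin: "\<forall>x r. r > 0 \<longrightarrow> 0 < emeasure m (ball x r) \<and> emeasure m (ball x r) < \<infinity>"
    then have "0 < emeasure m (ball 0 1)" "emeasure m (ball 0 1) < \<infinity>"
      by simp_all
    moreover have "open (ball (0::'w) 1)" "ball (0::'w) 1 \<noteq> {}"
      by simp_all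
    ultimately show False
      using dichotomy[OF m] by fastforce
  qed
  with dichotomy show ?thesis by blast
qed

end
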